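(* The basic non-distributive modal logic $\mathbf{L}$ is complete with respect to the class of graph-based $\mathcal{L}$-frames: if an $\mathcal{L}$-sequent $\phi\vdash\psi$ satisfies $\mathbb{F}\models\phi\vdash\psi$ for every graph-based $\mathcal{L}$-frame $\mathbb{F}$, then $\phi\vdash\psi\in\mathbf{L}$.
   Context: $\mathcal{L}$-formulas: $\varphi::=\bot\mid\top\mid p\mid\varphi\wedge\varphi\mid\varphi\vee\varphi\mid\Box\varphi\mid\Diamond\varphi$, $p\in\mathsf{Prop}$. $\mathbf{L}$ is the smallest set of sequents containing $p\vdash p$, $\bot\vdash p$, $p\vdash\top$, $p\vdash p\vee q$, $q\vdash p\vee q$, $p\wedge q\vdash p$, $p\wedge q\vdash q$, $\top\vdash\Box\top$, $\Box p\wedge\Box q\vdash\Box(p\wedge q)$, $\Diamond\bot\vdash\bot$, $\Diamond p\vee\Diamond q\vdash\Diamond(p\vee q)$, closed under cut, uniform substitution, (from $\chi\vdash\phi,\chi\vdash\psi$ infer $\chi\vdash\phi\wedge\psi$), (from $\phi\vdash\chi,\psi\vdash\chi$ infer $\phi\vee\psi\vdash\chi$), and (from $\phi\vdash\psi$ infer $\Box\phi\vdash\Box\psi$ and $\Diamond\phi\vdash\Diamond\psi$). For $T\subseteq Z\times Z$: $T^{[1]}[B]=\{y\mid\forall b\in B\,((b,y)\notin T)\}$, $T^{[0]}[Y]=\{b\mid\forall y\in Y\,((b,y)\notin T)\}$. A graph-based $\mathcal{L}$-frame $\mathbb{F}=(Z,E,R_\Diamond,R_\Box)$: $Z$ nonempty,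 $E$ reflexive, and with $B^{[1]}:=E^{[1]}[B]$, $Y^{[0]}:=E^{[0]}[Y]$, $B^{[10]}:=(B^{[1]})^{[0]}$, $Y^{[01]}:=(Y^{[0]})^{[1]}$, for all $b,y$: $(R_\Box^{[0]}[y])^{[10]}\subseteq R_\Box^{[0]}[y]$, $(R_\Box^{[1]}[b])^{[01]}\subseteq R_\Box^{[1]}[b]$, $(R_\Diamond^{[0]}[b])^{[10]}\subseteq R_\Diamond^{[0]}[b]$, $(R_\Diamond^{[1]}[y])^{[01]}\subseteq R_\Diamond^{[1]}[y]$. A model assigns to each $p$ a pair $([\![p]\!],(\![p]\!))$ with $[\![p]\!]^{[1]}=(\![p]\!)$, $(\![p]\!)^{[0]}=[\![p]\!]$, extended by: $[\![\top]\!]=Z,(\![\top]\!)=\emptyset$; $[\![\bot]\!]=\emptyset,(\![\bot]\!)=Z$; $[\![\phi\wedge\psi]\!]=[\![\phi]\!]\cap[\![\psi]\!]$, $(\![\phi\wedge\psi]\!)=[\![\phi\wedge\psi]\!]^{[1]}$; $(\![\phi\vee\psi]\!)=(\![\phi]\!)\cap(\![\psi]\!)$, $[\![\phi\vee\psi]\!]=(\![\phi\vee\psi]\!)^{[0]}$; $[\![\Box\phi]\!]=R_\Box^{[0]}[(\![\phi]\!)]$, $(\![\Box\phi]\!)=[\![\Box\phi]\!]^{[1]}$; $(\![\Diamond\phi]\!)=R_\Diamond^{[0]}[[\![\phi]\!]]$, $[\![\Diamond\phi]\!]=(\![\Diamond\phi]\!)^{[0]}$. $\phi\vdash\psi$ is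 true in the model if $z\in[\![\phi]\!]$ and $z'\in(\![\psi]\!)$ imply $(z,z')\notin E$; $\mathbb{F}\models\phi\vdash\psi$ iff true in all models on $\mathbb{F}$. *)

theory Defs
  imports Main
begin

datatype 'p fm =
    Bot (\<open>\<^bold>\<bottom>\<close>)
  | Top (\<open>\<^bold>\<top>\<close>)
  | Atom 'p
  | Conj "'p fm" "'p fm" (infixr \<open>\<^bold>\<and>\<close> 65)
  | Disj "'p fm" "'p fm" (infixr \<open>\<^bold>\<or>\<close> 60)
  | Box "'p fm" (\<open>\<^bold>\<box> _\<close> [70] 70)
  | Dia "'p fm" (\<open>\<^bold>\<diamond> _\<close> [70] 70)

primrec subst :: "('p \<Rightarrow> 'p fm) \<Rightarrow> 'p fm \<Rightarrow> 'p fm" where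
  "subst \<sigma> \<^bold>\<bottom> = \<^bold>\<bottom>"
| "subst \<sigma> \<^bold>\<top> = \<^bold>\<top>"
| "subst \<sigma> (Atom p) = \<sigma> p"
| "subst \<sigma> (\<phi> \<^bold>\<and> \<psi>) = subst \<sigma> \<phi> \<^bold>\<and> subst \<sigma> \<psi>"
| "subst \<sigma> (\<phi> \<^bold>\<or> \<psi>) = subst \<sigma> \<phi> \<^bold>\<or> subst \<sigma> \<psi>"
| "subst \<sigma> (\<^bold>\<box> \<phi>) = \<^bold>\<box> (subst \<sigma> \<phi>)"
| "subst \<sigma> (\<^bold>\<diamond> \<phi>) = \<^bold>\<diamond> (subst \<sigma> \<phi>)"

text \<open>A sequent is a pair of formulas. The axioms are about atoms only; their instances for
  compound formulas come from closure under (simultaneous) uniform substitution. Note the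
  direction of \<open>ax_dia_disj\<close>: the converse sequent is not an axiom.\<close>

type_synonym 'p sequent = "'p fm \<times> 'p fm"

abbreviation sequent :: "'p fm \<Rightarrow> 'p fm \<Rightarrow> 'p sequent" (infix \<open>\<turnstile>\<close> 55) where
  "\<phi> \<turnstile> \<psi> \<equiv> (\<phi>, \<psi>)"

inductive_set L :: "'p sequent set" where
  ax_id: "Atom p \<turnstile> Atom p \<in> L"
| ax_bot: "\<^bold>\<bottom> \<turnstile> Atom p \<in> L"
| ax_top: "Atom p \<turnstile> \<^bold>\<top> \<in> L"
| ax_disj1: "Atom p \<turnstile> Atom p \<^bold>\<or> Atom q \<in> L"
| ax_disj2: "Atom q \<turnstile> Atom p \<^bold>\<or> Atom q \<in> L"
| ax_conj1: "Atom p \<^bold>\<and> Atom q \<turnstile> Atom p \<in> L"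
| ax_conj2: "Atom p \<^bold>\<and> Atom q \<turnstile> Atom q \<in> L"
| ax_box_top: "\<^bold>\<top> \<turnstile> \<^bold>\<box> \<^bold>\<top> \<in> L"
| ax_box_conj: "\<^bold>\<box> (Atom p) \<^bold>\<and> \<^bold>\<box> (Atom q) \<turnstile> \<^bold>\<box> (Atom p \<^bold>\<and> Atom q) \<in> L"
| ax_dia_bot: "\<^bold>\<diamond> \<^bold>\<bottom> \<turnstile> \<^bold>\<bottom> \<in> L"
| ax_dia_disj: "\<^bold>\<diamond> (Atom p) \<^bold>\<or> \<^bold>\<diamond> (Atom q) \<turnstile> \<^bold>\<diamond> (Atom p \<^bold>\<or> Atom q) \<in> L"
| cut: "\<phi> \<turnstile> \<chi> \<in> L \<Longrightarrow> \<chi> \<turnstile> \<psi> \<in> L \<Longrightarrow> \<phi> \<turnstile> \<psi> \<in> L"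
| substitution: "\<phi> \<turnstile> \<psi> \<in> L \<Longrightarrow> subst \<sigma> \<phi> \<turnstile> subst \<sigma> \<psi> \<in> L"
| conj_right: "\<chi> \<turnstile> \<phi> \<in> L \<Longrightarrow> \<chi> \<turnstile> \<psi> \<in> L \<Longrightarrow> \<chi> \<turnstile> \<phi> \<^bold>\<and> \<psi> \<in> L"
| disj_left: "\<phi> \<turnstile> \<chi> \<in> L \<Longrightarrow> \<psi> \<turnstile> \<chi> \<in> L \<Longrightarrow> \<phi> \<^bold>\<or> \<psi> \<turnstile> \<chi> \<in> L"
| box_mono: "\<phi> \<turnstile> \<psi> \<in> L \<Longrightarrow> \<^bold>\<box> \<phi> \<turnstile> \<^bold>\<box> \<psi> \<in> L"
| dia_mono: "\<phi> \<turnstile> \<psi> \<in> L \<Longrightarrow> \<^bold>\<diamond> \<phi> \<turnstile> \<^bold>\<diamond> \<psi> \<in> L"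

text \<open>All operators on sets of states are relative to the carrier \<open>Z\<close> of a frame.\<close>

definition rel1 :: "'z set \<Rightarrow> ('z \<times> 'z) set \<Rightarrow> 'z set \<Rightarrow> 'z set" where
  "rel1 Z T B = {y \<in> Z. \<forall>b \<in> B. (b, y) \<notin> T}"

definition rel0 :: "'z set \<Rightarrow> ('z \<times> 'z) set \<Rightarrow> 'z set \<Rightarrow> 'z set" where
  "rel0 Z T Y = {b \<in> Z. \<forall>y \<in> Y. (b, y) \<notin> T}"

record 'z frame =
  states :: "'z set"
  edges :: "('z \<times> 'z) set"
  rdia :: "('z \<times> 'z) set"
  rbox :: "('z \<times> 'z) set"

definition up :: "'z frame \<Rightarrow> 'z set \<Rightarrow> 'z set" where
  "up F B = rel1 (states F) (edges F) B"

definition down :: "'z frame \<Rightarrow> 'z set \<Rightarrow> 'z set" where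
  "down F Y = rel0 (states F) (edges F) Y"

abbreviation dia0 :: "'z frame \<Rightarrow> 'z set \<Rightarrow> 'z set" where
  "dia0 F \<equiv> rel0 (states F) (rdia F)"

abbreviation dia1 :: "'z frame \<Rightarrow> 'z set \<Rightarrow> 'z set" where
  "dia1 F \<equiv> rel1 (states F) (rdia F)"

abbreviation box0 :: "'z frame \<Rightarrow> 'z set \<Rightarrow> 'z set" where
  "box0 F \<equiv> rel0 (states F) (rbox F)"

abbreviation box1 :: "'z frame \<Rightarrow> 'z set \<Rightarrow> 'z set" where
  "box1 F \<equiv> rel1 (states F) (rbox F)"

text \<open>The closure [10] is \<open>\<lambda>B. down F (up F B)\<close> and [01] is \<open>\<lambda>Y. up F (down F Y)\<close>. Both the box and the
  diamond relation have the closure [10] on their 0-sections and [01] on their 1-sections.\<close>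

definition graph_frame :: "'z frame \<Rightarrow> bool" where
  "graph_frame F \<longleftrightarrow>
     states F \<noteq> {} \<and>
     edges F \<subseteq> states F \<times> states F \<and>
     rdia F \<subseteq> states F \<times> states F \<and>
     rbox F \<subseteq> states F \<times> states F \<and>
     (\<forall>z \<in> states F. (z, z) \<in> edges F) \<and>
     (\<forall>y \<in> states F. down F (up F (box0 F {y})) \<subseteq> box0 F {y}) \<and>
     (\<forall>b \<in> states F. up F (down F (box1 F {b})) \<subseteq> box1 F {b}) \<and>
     (\<forall>b \<in> states F. down F (up F (dia0 F {b})) \<subseteq> dia0 F {b}) \<and>
     (\<forall>y \<in> states F. up F (down F (dia1 F {y})) \<subseteq> dia1 F {y})"

text \<open>A valuation \<open>V\<close> gives both components for every atom: \<open>fst (V p)\<close> is the extension,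
  \<open>snd (V p)\<close> the intension. The equations below force both to be sets of states.\<close>

type_synonym ('p, 'z) valuation = "'p \<Rightarrow> 'z set \<times> 'z set"

definition is_valuation :: "'z frame \<Rightarrow> ('p, 'z) valuation \<Rightarrow> bool" where
  "is_valuation F V \<longleftrightarrow> (\<forall>p. up F (fst (V p)) = snd (V p) \<and> down F (snd (V p)) = fst (V p))"

text \<open>The derived component of a compound formula is \<open>up F\<close> of its extension or \<open>down F\<close> of its
  intension, with that other component written out to make the recursion structural.\<close>

fun ext :: "'z frame \<Rightarrow> ('p, 'z) valuation \<Rightarrow> 'p fm \<Rightarrow> 'z set"
  and intn :: "'z frame \<Rightarrow> ('p, 'z) valuation \<Rightarrow> 'p fm \<Rightarrow> 'z set" where
  "ext F V (Atom p) = fst (V p)"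
| "ext F V \<^bold>\<top> = states F"
| "ext F V \<^bold>\<bottom> = {}"
| "ext F V (\<phi> \<^bold>\<and> \<psi>) = ext F V \<phi> \<inter> ext F V \<psi>"
| "ext F V (\<phi> \<^bold>\<or> \<psi>) = down F (intn F V \<phi> \<inter> intn F V \<psi>)"
| "ext F V (\<^bold>\<box> \<phi>) = box0 F (intn F V \<phi>)"
| "ext F V (\<^bold>\<diamond> \<phi>) = down F (dia0 F (ext F V \<phi>))"
| "intn F V (Atom p) = snd (V p)"
| "intn F V \<^bold>\<top> = {}"
| "intn F V \<^bold>\<bottom> = states F"
| "intn F V (\<phi> \<^bold>\<and> \<psi>) = up F (ext F V \<phi> \<inter> ext F V \<psi>)"
| "intn F V (\<phi> \<^bold>\<or> \<psi>) = intn F V \<phi> \<inter> intn F V \<psi>"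
| "intn F V (\<^bold>\<box> \<phi>) = up F (box0 F (intn F V \<phi>))"
| "intn F V (\<^bold>\<diamond> \<phi>) = dia0 F (ext F V \<phi>)"

definition true_in :: "'z frame \<Rightarrow> ('p, 'z) valuation \<Rightarrow> 'p sequent \<Rightarrow> bool" where
  "true_in F V s \<longleftrightarrow>
     (\<forall>z \<in> ext F V (fst s). \<forall>z' \<in> intn F V (snd s). (z, z') \<notin> edges F)"

definition valid_on :: "'z frame \<Rightarrow> 'p sequent \<Rightarrow> bool" (infix \<open>\<Turnstile>\<close> 50) where
  "F \<Turnstile> s \<longleftrightarrow> (\<forall>V. is_valuation F V \<longrightarrow> true_in F V s)"

end

(* The canonical frame. Its core states are the disjoint pairs (F, J) of a filter and an ideal of the
   Lindenbaum algebra, with (F, J) related to (F', J') unless F meets J', as usual.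

   The frame conditions ask the 0-sections of the diamond relation to be [10]-closed and its 1-sections
   to be [01]-closed, and the diamond of the logic is monotone and strict but not additive, so the core
   alone does not form a frame. The canonical diamond sections are {y. J_y meets Dia F} for a filter F
   and {b. Dia F_b meets J} for an ideal J. For each such section that is not the whole frame one extra
   state is added whose down-set, respectively up-set, is exactly this section; as a member of
   extensions and intensions it counts as the pair of the least filter and the least ideal. The core
   states whose filter or ideal is least lie outside all proper sections, so the extra states do not
   disturb the truth lemma. *)

theory Submission
  imports Defs
begin

section \<open>The Lindenbaum algebra\<close>

definition is_filter :: "'p fm set \<Rightarrow> bool" where
  "is_filter F \<longleftrightarrow> \<^bold>\<top> \<in> F \<and> (\<forall>\<alpha> \<in> F. \<forall>\<beta>. \<alpha> \<turnstile> \<beta> \<in> L \<longrightarrow> \<beta> \<in> F) \<and> (\<forall>\<alpha> \<in> F. \<forall>\<beta> \<in> F. \<alpha> \<^bold>\<and> \<beta> \<in> F)"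

definition is_ideal :: "'p fm set \<Rightarrow> bool" where
  "is_ideal J \<longleftrightarrow> \<^bold>\<bottom> \<in> J \<and> (\<forall>\<beta> \<in> J. \<forall>\<alpha>. \<alpha> \<turnstile> \<beta> \<in> L \<longrightarrow> \<alpha> \<in> J) \<and> (\<forall>\<alpha> \<in> J. \<forall>\<beta> \<in> J. \<alpha> \<^bold>\<or> \<beta> \<in> J)"

text \<open>Principal filters and ideals; \<open>above Top\<close> is the least filter and
  \<open>below Bot\<close> the least ideal.\<close>

definition above :: "'p fm \<Rightarrow> 'p fm set" where
  "above \<alpha> = {\<beta>. \<alpha> \<turnstile> \<beta> \<in> L}"

definition below :: "'p fm \<Rightarrow> 'p fm set" where
  "below \<beta> = {\<alpha>. \<alpha> \<turnstile> \<beta> \<in> L}"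

lemma L_refl: "\<phi> \<turnstile> \<phi> \<in> L"
  using substitution[OF ax_id, of "\<lambda>_. \<phi>"] by simp

lemma L_bot: "\<^bold>\<bottom> \<turnstile> \<phi> \<in> L"
  using substitution[OF ax_bot, of "\<lambda>_. \<phi>"] by simp

lemma L_top: "\<phi> \<turnstile> \<^bold>\<top> \<in> L"
  using substitution[OF ax_top, of "\<lambda>_. \<phi>"] by simp

text \<open>The binary axioms mention two atoms, which substitution replaces independently only if
  they differ. Consistency makes the least filter and the least ideal disjoint.\<close>

locale consistent_logic =
  fixes p q :: 'p
  assumes distinct_atoms: "p \<noteq> q"
    and consistent: "(\<^bold>\<top> :: 'p fm) \<turnstile> \<^bold>\<bottom> \<notin> L"
begin

lemma L_conj1: "\<phi> \<^bold>\<and> \<psi> \<turnstile> \<phi> \<in> L" for \<phi> \<psi> :: "'p fm"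
  using substitution[OF ax_conj1[of p q], of "\<lambda>r. if r = p then \<phi> else \<psi>"] distinct_atoms by simp

lemma L_conj2: "\<phi> \<^bold>\<and> \<psi> \<turnstile> \<psi> \<in> L" for \<phi> \<psi> :: "'p fm"
  using substitution[OF ax_conj2[of p q], of "\<lambda>r. if r = p then \<phi> else \<psi>"] distinct_atoms by simp

lemma L_disj1: "\<phi> \<turnstile> \<phi> \<^bold>\<or> \<psi> \<in> L" for \<phi> \<psi> :: "'p fm"
  using substitution[OF ax_disj1[of p q], of "\<lambda>r. if r = p then \<phi> else \<psi>"] distinct_atoms by simp

lemma L_disj2: "\<psi> \<turnstile> \<phi> \<^bold>\<or> \<psi> \<in> L" for \<phi> \<psi> :: "'p fm"
  using substitution[OF ax_disj2[of q p], of "\<lambda>r. if r = p then \<phi> else \<psi>"] distinct_atoms by simp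

lemma L_box_conj: "\<^bold>\<box> \<phi> \<^bold>\<and> \<^bold>\<box> \<psi> \<turnstile> \<^bold>\<box> (\<phi> \<^bold>\<and> \<psi>) \<in> L" for \<phi> \<psi> :: "'p fm"
  using substitution[OF ax_box_conj[of p q], of "\<lambda>r. if r = p then \<phi> else \<psi>"] distinct_atoms by simp

lemma filter_conj_iff: "is_filter F \<Longrightarrow> \<phi> \<^bold>\<and> \<psi> \<in> F \<longleftrightarrow> \<phi> \<in> F \<and> \<psi> \<in> F" for \<phi> \<psi> :: "'p fm"
  unfolding is_filter_def using L_conj1 L_conj2 by blast

lemma ideal_disj_iff: "is_ideal J \<Longrightarrow> \<phi> \<^bold>\<or> \<psi> \<in> J \<longleftrightarrow> \<phi> \<in> J \<and> \<psi> \<in> J" for \<phi> \<psi> :: "'p fm"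
  unfolding is_ideal_def using L_disj1 L_disj2 by blast

lemma filter_above: "is_filter (above \<phi>)" for \<phi> :: "'p fm"
  by (auto simp: is_filter_def above_def intro: L_top cut conj_right)

lemma ideal_below: "is_ideal (below \<phi>)" for \<phi> :: "'p fm"
  by (auto simp: is_ideal_def below_def intro: L_bot cut disj_left)

lemma filter_box_preimage:
  fixes F :: "'p fm set"
  assumes "is_filter F"
  shows "is_filter {\<chi>. \<^bold>\<box> \<chi> \<in> F}"
  using assms ax_box_top L_box_conj box_mono unfolding is_filter_def by blast

text \<open>Boxes need not preserve joins, but by monotonicity two boxes of members of
  \<open>J\<close> lie below the box of their disjunction, so these boxes are directed.\<close>

lemma ideal_box_image:
  fixes J :: "'p fm set"
  assumes "is_ideal J"
  shows "is_ideal {\<alpha>. \<exists>\<chi> \<in> J. \<alpha> \<turnstile> \<^bold>\<box> \<chi> \<in> L}"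
proof -
  have "\<alpha> \<^bold>\<or> \<beta> \<turnstile> \<^bold>\<box> (\<chi> \<^bold>\<or> \<xi>) \<in> L"
    if "\<alpha> \<turnstile> \<^bold>\<box> \<chi> \<in> L" "\<beta> \<turnstile> \<^bold>\<box> \<xi> \<in> L" for \<alpha> \<beta> \<chi> \<xi> :: "'p fm"
    using that by (meson L_disj1 L_disj2 box_mono cut disj_left)
  then show ?thesis
    using assms unfolding is_ideal_def by (blast intro: L_bot cut)
qed

section \<open>The canonical frame\<close>

text \<open>An extra state has one empty component: \<open>({}, J)\<close> is the state whose up-set is the diamond
  section of the ideal \<open>J\<close>, and \<open>(F, {})\<close> the one whose down-set is the diamond section of the filter
  \<open>F\<close>. Filters and ideals being nonempty, no such pair is a core state.\<close>

definition canon_states :: "('p fm set \<times> 'p fm set) set" where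
  "canon_states =
     {(F, J) | F J. is_filter F \<and> is_ideal J \<and> F \<inter> J = {}} \<union>
     {({}, J) | J. is_ideal J \<and> \<^bold>\<diamond> \<^bold>\<top> \<notin> J} \<union>
     {(F, {}) | F. is_filter F \<and> (\<forall>\<chi> \<in> F. \<^bold>\<diamond> \<chi> \<turnstile> \<^bold>\<bottom> \<notin> L)}"

definition filt :: "'p fm set \<times> 'p fm set \<Rightarrow> 'p fm set" where
  "filt z = (if fst z = {} \<or> snd z = {} then above \<^bold>\<top> else fst z)"

definition idl :: "'p fm set \<times> 'p fm set \<Rightarrow> 'p fm set" where
  "idl z = (if fst z = {} \<or> snd z = {} then below \<^bold>\<bottom> else snd z)"

text \<open>\<open>rel0\<close> and \<open>rel1\<close> collect unrelated points, so every relation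
  is given by complement. The last two clauses of \<open>edges\<close> delete pairs so as to shape
  the up-set of \<open>({}, J)\<close> and the down-set of \<open>(F, {})\<close>.
  \<open>rdia\<close> has the ideal side first because \<open>dia0\<close> takes extensions to
  intensions.\<close>

definition canon_frame :: "('p fm set \<times> 'p fm set) frame" where
  "canon_frame = \<lparr>
     states = canon_states,
     edges = {(z, y) \<in> canon_states \<times> canon_states.
       filt z \<inter> idl y = {} \<and>
       \<not> (fst z = {} \<and> (\<exists>\<chi> \<in> filt y. \<^bold>\<diamond> \<chi> \<in> snd z)) \<and>
       \<not> (snd y = {} \<and> (\<exists>\<chi> \<in> fst y. \<^bold>\<diamond> \<chi> \<in> idl z))},
     rdia = {(y, b) \<in> canon_states \<times> canon_states. \<forall>\<chi> \<in> filt b. \<^bold>\<diamond> \<chi> \<notin> idl y},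
     rbox = {(b, y) \<in> canon_states \<times> canon_states. \<forall>\<chi> \<in> idl y. \<^bold>\<box> \<chi> \<notin> filt b}\<rparr>"

definition canon_ext :: "'p fm \<Rightarrow> ('p fm set \<times> 'p fm set) set" where
  "canon_ext \<phi> = {z \<in> canon_states. \<phi> \<in> filt z}"

definition canon_int :: "'p fm \<Rightarrow> ('p fm set \<times> 'p fm set) set" where
  "canon_int \<phi> = {z \<in> canon_states. \<phi> \<in> idl z}"

section \<open>Filters and ideals carried by the canonical states\<close>

lemma core_state:
  assumes "is_filter F" "is_ideal J" "F \<inter> J = {}"
  shows "(F, J) \<in> canon_states" "filt (F, J) = F" "idl (F, J) = J"
  using assms by (auto simp: canon_states_def filt_def idl_def is_filter_def is_ideal_def)

lemma filter_state:
  assumes "is_filter F" "\<^bold>\<bottom> \<notin> F"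
  shows "(F, below \<^bold>\<bottom>) \<in> canon_states" "filt (F, below \<^bold>\<bottom>) = F" "idl (F, below \<^bold>\<bottom>) = below \<^bold>\<bottom>"
proof -
  have "F \<inter> below \<^bold>\<bottom> = {}"
    using assms by (auto simp: is_filter_def below_def)
  from core_state[OF assms(1) ideal_below this]
  show "(F, below \<^bold>\<bottom>) \<in> canon_states" "filt (F, below \<^bold>\<bottom>) = F" "idl (F, below \<^bold>\<bottom>) = below \<^bold>\<bottom>"
    by blast+
qed

lemma ideal_state:
  assumes "is_ideal J" "\<^bold>\<top> \<notin> J"
  shows "(above \<^bold>\<top>, J) \<in> canon_states" "filt (above \<^bold>\<top>, J) = above \<^bold>\<top>" "idl (above \<^bold>\<top>, J) = J"
proof -
  have "above \<^bold>\<top> \<inter> J = {}"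
    using assms by (auto simp: is_ideal_def above_def)
  from core_state[OF filter_above assms(1) this]
  show "(above \<^bold>\<top>, J) \<in> canon_states" "filt (above \<^bold>\<top>, J) = above \<^bold>\<top>" "idl (above \<^bold>\<top>, J) = J"
    by blast+
qed

lemma filter_filt: "z \<in> canon_states \<Longrightarrow> is_filter (filt z)"
  by (auto simp: canon_states_def filt_def filter_above)

lemma ideal_idl: "z \<in> canon_states \<Longrightarrow> is_ideal (idl z)"
  by (auto simp: canon_states_def idl_def ideal_below)

lemma filt_idl_disjoint: "z \<in> canon_states \<Longrightarrow> filt z \<inter> idl z = {}"
proof -
  have "above \<^bold>\<top> \<inter> below \<^bold>\<bottom> = ({} :: 'p fm set)"
    using consistent by (auto simp: above_def below_def intro: cut)
  then show "z \<in> canon_states \<Longrightarrow> filt z \<inter> idl z = {}"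
    by (auto simp: canon_states_def filt_def idl_def)
qed

lemma filt_mono: "\<lbrakk>z \<in> canon_states; \<alpha> \<in> filt z; \<alpha> \<turnstile> \<beta> \<in> L\<rbrakk> \<Longrightarrow> \<beta> \<in> filt z"
  using filter_filt unfolding is_filter_def by blast

lemma idl_antimono: "\<lbrakk>z \<in> canon_states; \<beta> \<in> idl z; \<alpha> \<turnstile> \<beta> \<in> L\<rbrakk> \<Longrightarrow> \<alpha> \<in> idl z"
  using ideal_idl unfolding is_ideal_def by blast

lemma top_in_filt: "z \<in> canon_states \<Longrightarrow> \<^bold>\<top> \<in> filt z"
  using filter_filt unfolding is_filter_def by blast

lemma bot_in_idl: "z \<in> canon_states \<Longrightarrow> \<^bold>\<bottom> \<in> idl z"
  using ideal_idl unfolding is_ideal_def by blast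

lemma top_notin_idl: "z \<in> canon_states \<Longrightarrow> \<^bold>\<top> \<notin> idl z"
  using top_in_filt filt_idl_disjoint by blast

lemma bot_notin_filt: "z \<in> canon_states \<Longrightarrow> \<^bold>\<bottom> \<notin> filt z"
  using bot_in_idl filt_idl_disjoint by blast

text \<open>\<open>Dia Top\<close> entails \<open>Dia \<chi>\<close> for every theorem \<chi>, so
  the ideal would contain \<open>Dia Top\<close>. Hence deletions at a left extra state spare all
  targets with least filter.\<close>

lemma left_extra:
  assumes "z \<in> canon_states" "fst z = {}" "\<chi> \<in> above \<^bold>\<top>"
  shows "\<^bold>\<diamond> \<chi> \<notin> snd z"
proof
  assume \<chi>: "\<^bold>\<diamond> \<chi> \<in> snd z"
  from assms(1,2) have "is_ideal (snd z)" "\<^bold>\<diamond> \<^bold>\<top> \<notin> snd z"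
    by (auto simp: canon_states_def is_filter_def)
  then show False
    using \<chi> assms(3) dia_mono[of "\<^bold>\<top>" \<chi>] by (auto simp: above_def is_ideal_def)
qed

text \<open>Dually, deletions at a right extra state spare all sources with least ideal.\<close>

lemma right_extra:
  assumes "z \<in> canon_states" "snd z = {}" "\<chi> \<in> fst z"
  shows "\<^bold>\<diamond> \<chi> \<notin> below \<^bold>\<bottom>"
  using assms by (auto simp: canon_states_def is_ideal_def below_def)

text \<open>An extra state has least filter and least ideal, so neither deletion clause hits its
  loop.\<close>

lemma canon_edges_refl:
  assumes "z \<in> canon_states"
  shows "(z, z) \<in> edges canon_frame"
proof -
  have "\<^bold>\<diamond> \<chi> \<notin> snd z" if "fst z = {}" "\<chi> \<in> filt z" for \<chi>
    using that left_extra[OF assms] by (simp add: filt_def)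
  moreover have "\<^bold>\<diamond> \<chi> \<notin> idl z" if "snd z = {}" "\<chi> \<in> fst z" for \<chi>
    using that right_extra[OF assms] by (simp add: idl_def)
  ultimately show ?thesis
    using assms filt_idl_disjoint by (auto simp: canon_frame_def)
qed

section \<open>Up-sets and down-sets of single states\<close>

lemma states_canon_frame: "states canon_frame = canon_states"
  by (simp add: canon_frame_def)

text \<open>\<open>Z\<close> is the section of the empty set, and sections are closed under the
  Galois connection of \<open>T\<close>; all modal sections are brought into this form
  below.\<close>

lemma down_closure:
  assumes "A = Z \<or> (\<exists>y \<in> Z. A = rel0 Z T {y})"
  shows "rel0 Z T (rel1 Z T A) \<subseteq> A"
  using assms by (auto simp: rel0_def rel1_def)

lemma up_closure:
  assumes "A = Z \<or> (\<exists>b \<in> Z. A = rel1 Z T {b})"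
  shows "rel1 Z T (rel0 Z T A) \<subseteq> A"
  using assms by (auto simp: rel0_def rel1_def)

text \<open>Least ideal: the disjointness clause always holds. Least filter:
  \<open>left_extra\<close> excludes deletions at left extra states. Only the state's own deletion
  clause remains; \<open>up_ideal_extra\<close> is dual.\<close>

lemma down_filter_extra:
  assumes "(F, {}) \<in> canon_states" "is_filter F"
  shows "down canon_frame {(F, {})} = {z \<in> canon_states. \<exists>\<chi> \<in> F. \<^bold>\<diamond> \<chi> \<in> idl z}"
proof -
  have "filt z \<inter> below \<^bold>\<bottom> = {}" if "z \<in> canon_states" for z
    using bot_notin_filt[OF that] filt_mono[OF that] by (auto simp: below_def)
  moreover have "\<^bold>\<diamond> \<chi> \<notin> snd z" if "z \<in> canon_states" "fst z = {}" "\<chi> \<in> above \<^bold>\<top>" for z \<chi>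
    using that left_extra by blast
  ultimately show ?thesis
    using assms(1)
    by (auto simp: down_def rel0_def canon_frame_def filt_def[of "(F, {})"] idl_def[of "(F, {})"])
qed

lemma up_ideal_extra:
  assumes "({}, J) \<in> canon_states" "is_ideal J"
  shows "up canon_frame {({}, J)} = {y \<in> canon_states. \<exists>\<chi> \<in> filt y. \<^bold>\<diamond> \<chi> \<in> J}"
proof -
  have "above \<^bold>\<top> \<inter> idl y = {}" if "y \<in> canon_states" for y
    using top_notin_idl[OF that] idl_antimono[OF that] by (auto simp: above_def)
  moreover have "\<^bold>\<diamond> \<chi> \<notin> below \<^bold>\<bottom>" if "y \<in> canon_states" "snd y = {}" "\<chi> \<in> fst y" for y \<chi>
    using that right_extra by blast
  ultimately show ?thesis
    using assms(1)
    by (auto simp: up_def rel1_def canon_frame_def filt_def[of "({}, J)"] idl_def[of "({}, J)"])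
qed

text \<open>Disjointness alone decides: the filter is least, so \<open>left_extra\<close> applies,
  and \<open>Bot\<close> in \<open>J\<close> shows that the pair is not a right extra state.\<close>

lemma down_ideal_state:
  assumes "is_ideal J" "\<^bold>\<top> \<notin> J"
  shows "down canon_frame {(above \<^bold>\<top>, J)} = {z \<in> canon_states. filt z \<inter> J \<noteq> {}}"
proof -
  have "\<^bold>\<bottom> \<in> J"
    using assms by (simp add: is_ideal_def)
  then show ?thesis
    using ideal_state[OF assms] left_extra
    by (auto simp: down_def rel0_def canon_frame_def)
qed

lemma up_filter_state:
  assumes "is_filter F" "\<^bold>\<bottom> \<notin> F"
  shows "up canon_frame {(F, below \<^bold>\<bottom>)} = {y \<in> canon_states. F \<inter> idl y \<noteq> {}}"
proof -
  have "\<^bold>\<top> \<in> F"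
    using assms by (simp add: is_filter_def)
  then show ?thesis
    using filter_state[OF assms] right_extra
    by (auto simp: up_def rel1_def canon_frame_def)
qed

section \<open>Modal sections and their closedness\<close>

lemma canon_box0:
  assumes "Y \<subseteq> canon_states"
  shows "box0 canon_frame Y = {b \<in> canon_states. \<forall>y \<in> Y. \<exists>\<chi> \<in> idl y. \<^bold>\<box> \<chi> \<in> filt b}"
  using assms by (auto simp: rel0_def canon_frame_def)

lemma canon_box1:
  assumes "B \<subseteq> canon_states"
  shows "box1 canon_frame B = {y \<in> canon_states. \<forall>b \<in> B. \<exists>\<chi> \<in> idl y. \<^bold>\<box> \<chi> \<in> filt b}"
  using assms by (auto simp: rel1_def canon_frame_def)

lemma canon_dia0:
  assumes "B \<subseteq> canon_states"
  shows "dia0 canon_frame B = {y \<in> canon_states. \<forall>b \<in> B. \<exists>\<chi> \<in> filt b. \<^bold>\<diamond> \<chi> \<in> idl y}"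
  using assms by (auto simp: rel0_def canon_frame_def)

lemma canon_dia1:
  assumes "Y \<subseteq> canon_states"
  shows "dia1 canon_frame Y = {b \<in> canon_states. \<forall>y \<in> Y. \<exists>\<chi> \<in> filt b. \<^bold>\<diamond> \<chi> \<in> idl y}"
  using assms by (auto simp: rel1_def canon_frame_def)

text \<open>A filter contains some \<open>Box \<chi>\<close> with \<chi> in \<open>idl y\<close> iff
  it meets the ideal generated by these boxes, so a core state realises a proper section.\<close>

lemma canon_box0_extent:
  assumes y: "y \<in> canon_states"
  shows "box0 canon_frame {y} = canon_states \<or>
    (\<exists>y' \<in> canon_states. box0 canon_frame {y} = down canon_frame {y'})"
proof -
  define J where "J = {\<alpha>. \<exists>\<chi> \<in> idl y. \<alpha> \<turnstile> \<^bold>\<box> \<chi> \<in> L}"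
  have J: "is_ideal J"
    unfolding J_def using ideal_box_image ideal_idl[OF y] .
  have box0: "box0 canon_frame {y} = {b \<in> canon_states. filt b \<inter> J \<noteq> {}}"
    using y unfolding J_def by (auto simp: canon_box0 intro: filt_mono L_refl)
  show ?thesis
  proof (cases "\<^bold>\<top> \<in> J")
    case True
    then show ?thesis
      using box0 top_in_filt by blast
  next
    case False
    then show ?thesis
      using box0 down_ideal_state[OF J False] ideal_state(1)[OF J False]
      by (intro disjI2 bexI[of _ "(above \<^bold>\<top>, J)"]) simp_all
  qed
qed

lemma canon_box1_intent:
  assumes b: "b \<in> canon_states"
  shows "box1 canon_frame {b} = canon_states \<or>
    (\<exists>b' \<in> canon_states. box1 canon_frame {b} = up canon_frame {b'})"
proof -
  define F where "F = {\<chi>. \<^bold>\<box> \<chi> \<in> filt b}"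
  have F: "is_filter F"
    unfolding F_def using filter_box_preimage filter_filt[OF b] .
  have box1: "box1 canon_frame {b} = {y \<in> canon_states. F \<inter> idl y \<noteq> {}}"
    using b unfolding F_def by (auto simp: canon_box1)
  show ?thesis
  proof (cases "\<^bold>\<bottom> \<in> F")
    case True
    then show ?thesis
      using box1 bot_in_idl by blast
  next
    case False
    then show ?thesis
      using box1 up_filter_state[OF F False] filter_state(1)[OF F False]
      by (intro disjI2 bexI[of _ "(F, below \<^bold>\<bottom>)"]) simp_all
  qed
qed

text \<open>The diamonds of members of \<open>filt b\<close> generate a filter, so the section is by
  nature an up-set; the frame condition asks for a down-set, which the extra state
  \<open>(filt b, {})\<close> supplies.\<close>

lemma canon_dia0_extent:
  assumes b: "b \<in> canon_states"
  shows "dia0 canon_frame {b} = canon_states \<or>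
    (\<exists>y \<in> canon_states. dia0 canon_frame {b} = down canon_frame {y})"
proof (cases "\<exists>\<chi> \<in> filt b. \<^bold>\<diamond> \<chi> \<turnstile> \<^bold>\<bottom> \<in> L")
  \<comment> \<open>Such a \<open>Dia \<chi>\<close> lies in every ideal, so the section is the
    whole frame.\<close>
  case True
  then have "\<exists>\<chi> \<in> filt b. \<^bold>\<diamond> \<chi> \<in> idl y" if "y \<in> canon_states" for y
    using bot_in_idl[OF that] idl_antimono[OF that] by blast
  then show ?thesis
    using b by (auto simp: canon_dia0)
next
  case False
  then have "(filt b, {}) \<in> canon_states"
    using filter_filt[OF b] by (auto simp: canon_states_def)
  then show ?thesis
    using b down_filter_extra[OF _ filter_filt[OF b]]
    by (intro disjI2 bexI[of _ "(filt b, {})"]) (simp_all add: canon_dia0)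
qed

text \<open>\<open>Top\<close> lies in every filter, so \<open>Dia Top\<close> in
  \<open>idl y\<close> makes the section everything; otherwise \<open>({}, idl y)\<close> is an
  admissible extra state.\<close>

lemma canon_dia1_intent:
  assumes y: "y \<in> canon_states"
  shows "dia1 canon_frame {y} = canon_states \<or>
    (\<exists>b \<in> canon_states. dia1 canon_frame {y} = up canon_frame {b})"
proof (cases "\<^bold>\<diamond> \<^bold>\<top> \<in> idl y")
  case True
  then show ?thesis
    using y by (auto simp: canon_dia1 intro: top_in_filt)
next
  case False
  then have "({}, idl y) \<in> canon_states"
    using ideal_idl[OF y] by (auto simp: canon_states_def)
  then show ?thesis
    using y up_ideal_extra[OF _ ideal_idl[OF y]]
    by (intro disjI2 bexI[of _ "({}, idl y)"]) (simp_all add: canon_dia1)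
qed

lemma graph_frame_canon: "graph_frame canon_frame"
proof -
  have "(above \<^bold>\<top>, below \<^bold>\<bottom>) \<in> canon_states"
    using filter_state(1) filter_above consistent by (simp add: above_def)
  moreover have "edges canon_frame \<subseteq> canon_states \<times> canon_states"
    "rdia canon_frame \<subseteq> canon_states \<times> canon_states"
    "rbox canon_frame \<subseteq> canon_states \<times> canon_states"
    by (auto simp: canon_frame_def)
  moreover have "down canon_frame (up canon_frame A) \<subseteq> A"
    if "A = canon_states \<or> (\<exists>y \<in> canon_states. A = down canon_frame {y})" for A
    using that unfolding up_def down_def by (intro down_closure) (simp add: states_canon_frame)
  moreover have "up canon_frame (down canon_frame A) \<subseteq> A"
    if "A = canon_states \<or> (\<exists>b \<in> canon_states. A = up canon_frame {b})" for A
    using that unfolding up_def down_def by (intro up_closure) (simp add: states_canon_frame)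
  ultimately show ?thesis
    unfolding graph_frame_def
    using canon_edges_refl canon_box0_extent canon_box1_intent canon_dia0_extent canon_dia1_intent
    by (auto simp: states_canon_frame)
qed

section \<open>The truth lemma\<close>

text \<open>The generic state of \<phi>: its filter is the least one containing \<phi>, so a
  condition on all of \<open>canon_ext \<phi>\<close> can be tested here. \<open>below_state\<close>
  is dual.\<close>

lemma above_state:
  assumes "\<phi> \<turnstile> \<^bold>\<bottom> \<notin> L"
  shows "(above \<phi>, below \<^bold>\<bottom>) \<in> canon_ext \<phi>"
  using filter_state[OF filter_above[of \<phi>]] assms L_refl[of \<phi>] by (simp add: above_def canon_ext_def)

lemma below_state:
  assumes "\<^bold>\<top> \<turnstile> \<phi> \<notin> L"
  shows "(above \<^bold>\<top>, below \<phi>) \<in> canon_int \<phi>"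
  using ideal_state[OF ideal_below[of \<phi>]] assms L_refl[of \<phi>] by (simp add: below_def canon_int_def)

lemma edge_ext_int: "\<lbrakk>z \<in> canon_ext \<phi>; y \<in> canon_int \<phi>\<rbrakk> \<Longrightarrow> (z, y) \<notin> edges canon_frame"
  by (auto simp: canon_ext_def canon_int_def canon_frame_def)

lemma up_canon_ext: "up canon_frame (canon_ext \<phi>) = canon_int \<phi>"
proof
  show "canon_int \<phi> \<subseteq> up canon_frame (canon_ext \<phi>)"
    unfolding up_def rel1_def states_canon_frame using edge_ext_int canon_int_def by blast
  show "up canon_frame (canon_ext \<phi>) \<subseteq> canon_int \<phi>"
  proof
    fix y assume y: "y \<in> up canon_frame (canon_ext \<phi>)"
    then have Z: "y \<in> canon_states"
      by (simp add: up_def rel1_def states_canon_frame)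
    have "\<phi> \<in> idl y"
    proof (cases "\<phi> \<turnstile> \<^bold>\<bottom> \<in> L")
      \<comment> \<open>No state has \<phi> in its filter, so there is no generic state; but \<phi>
        lies in every ideal.\<close>
      case True
      then show ?thesis
        using Z bot_in_idl idl_antimono by blast
    next
      case False
      \<comment> \<open>The generic state forces \<open>idl y\<close> to meet
        \<open>above \<phi>\<close>, and downward closure yields \<phi>.\<close>
      then have "y \<in> up canon_frame {(above \<phi>, below \<^bold>\<bottom>)}"
        using y above_state[OF False] by (auto simp: up_def rel1_def)
      moreover have "\<^bold>\<bottom> \<notin> above \<phi>"
        using False by (simp add: above_def)
      ultimately show ?thesis
        using up_filter_state[OF filter_above] idl_antimono[OF Z] by (auto simp: above_def)
    qed
    then show "y \<in> canon_int \<phi>"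
      using Z by (simp add: canon_int_def)
  qed
qed

lemma down_canon_int: "down canon_frame (canon_int \<phi>) = canon_ext \<phi>"
proof
  show "canon_ext \<phi> \<subseteq> down canon_frame (canon_int \<phi>)"
    unfolding down_def rel0_def states_canon_frame using edge_ext_int canon_ext_def by blast
  show "down canon_frame (canon_int \<phi>) \<subseteq> canon_ext \<phi>"
  proof
    fix z assume z: "z \<in> down canon_frame (canon_int \<phi>)"
    then have Z: "z \<in> canon_states"
      by (simp add: down_def rel0_def states_canon_frame)
    have "\<phi> \<in> filt z"
    proof (cases "\<^bold>\<top> \<turnstile> \<phi> \<in> L")
      case True
      then show ?thesis
        using Z top_in_filt filt_mono by blast
    next
      case False
      then have "z \<in> down canon_frame {(above \<^bold>\<top>, below \<phi>)}"
        using z below_state[OF False] by (auto simp: down_def rel0_def)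
      moreover have "\<^bold>\<top> \<notin> below \<phi>"
        using False by (simp add: below_def)
      ultimately show ?thesis
        using down_ideal_state[OF ideal_below] filt_mono[OF Z] by (auto simp: below_def)
    qed
    then show "z \<in> canon_ext \<phi>"
      using Z by (simp add: canon_ext_def)
  qed
qed

text \<open>Testing at \<open>(above Top, below \<phi>)\<close> gives \<open>Box \<chi>\<close> in
  the filter with \<chi> entailing \<phi>, and monotonicity applies. If \<phi> is a theorem this
  state is missing and \<open>ax_box_top\<close> takes over; for the diamond,
  \<open>ax_dia_bot\<close> does so.\<close>

lemma box0_canon_int: "box0 canon_frame (canon_int \<phi>) = canon_ext (\<^bold>\<box> \<phi>)"
proof -
  have "\<^bold>\<box> \<phi> \<in> filt b"
    if b: "b \<in> canon_states" and all: "\<forall>y \<in> canon_int \<phi>. \<exists>\<chi> \<in> idl y. \<^bold>\<box> \<chi> \<in> filt b" for b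
  proof (cases "\<^bold>\<top> \<turnstile> \<phi> \<in> L")
    case True
    then show ?thesis
      using b top_in_filt filt_mono ax_box_top box_mono by blast
  next
    case False
    then have "\<exists>\<chi> \<in> below \<phi>. \<^bold>\<box> \<chi> \<in> filt b"
      using all below_state[OF False] ideal_state(3)[OF ideal_below[of \<phi>]] by (auto simp: below_def)
    then show ?thesis
      using filt_mono[OF b] box_mono by (auto simp: below_def)
  qed
  moreover have "canon_int \<phi> \<subseteq> canon_states"
    by (auto simp: canon_int_def)
  ultimately show ?thesis
    by (auto simp: canon_box0 canon_ext_def canon_int_def)
qed

lemma dia0_canon_ext: "dia0 canon_frame (canon_ext \<phi>) = canon_int (\<^bold>\<diamond> \<phi>)"
proof -
  have "\<^bold>\<diamond> \<phi> \<in> idl y"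
    if y: "y \<in> canon_states" and all: "\<forall>b \<in> canon_ext \<phi>. \<exists>\<chi> \<in> filt b. \<^bold>\<diamond> \<chi> \<in> idl y" for y
  proof (cases "\<phi> \<turnstile> \<^bold>\<bottom> \<in> L")
    case True
    then show ?thesis
      using y bot_in_idl idl_antimono ax_dia_bot dia_mono by blast
  next
    case False
    then have "\<exists>\<chi> \<in> above \<phi>. \<^bold>\<diamond> \<chi> \<in> idl y"
      using all above_state[OF False] filter_state(2)[OF filter_above[of \<phi>]] by (auto simp: above_def)
    then show ?thesis
      using idl_antimono[OF y] dia_mono by (auto simp: above_def)
  qed
  moreover have "canon_ext \<phi> \<subseteq> canon_states"
    by (auto simp: canon_ext_def)
  ultimately show ?thesis
    by (auto simp: canon_dia0 canon_ext_def canon_int_def)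
qed

lemma canon_ext_conj: "canon_ext \<phi> \<inter> canon_ext \<psi> = canon_ext (\<phi> \<^bold>\<and> \<psi>)"
  using filter_conj_iff filter_filt by (auto simp: canon_ext_def)

lemma canon_int_disj: "canon_int \<phi> \<inter> canon_int \<psi> = canon_int (\<phi> \<^bold>\<or> \<psi>)"
  using ideal_disj_iff ideal_idl by (auto simp: canon_int_def)

definition canon_val :: "('p, 'p fm set \<times> 'p fm set) valuation" where
  "canon_val r = (canon_ext (Atom r), canon_int (Atom r))"

lemma is_valuation_canon: "is_valuation canon_frame canon_val"
  by (simp add: is_valuation_def canon_val_def up_canon_ext down_canon_int)

lemma truth_lemma:
  "ext canon_frame canon_val \<phi> = canon_ext \<phi> \<and> intn canon_frame canon_val \<phi> = canon_int \<phi>"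
proof (induction \<phi>)
  case Bot
  show ?case
    using bot_in_idl bot_notin_filt by (auto simp: states_canon_frame canon_ext_def canon_int_def)
next
  case Top
  show ?case
    using top_in_filt top_notin_idl by (auto simp: states_canon_frame canon_ext_def canon_int_def)
qed (simp_all add: canon_val_def canon_ext_conj canon_int_disj box0_canon_int dia0_canon_ext
      up_canon_ext down_canon_int)

section \<open>Completeness\<close>

lemma canon_complete:
  fixes \<phi> \<psi> :: "'p fm"
  assumes "canon_frame \<Turnstile> \<phi> \<turnstile> \<psi>"
  shows "\<phi> \<turnstile> \<psi> \<in> L"
proof (rule ccontr)
  assume neg: "\<phi> \<turnstile> \<psi> \<notin> L"
  \<comment> \<open>One state refutes the sequent through its own loop; \<open>cut\<close> makes its
    components disjoint.\<close>
  let ?z = "(above \<phi>, below \<psi>)"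
  have "above \<phi> \<inter> below \<psi> = {}"
    using neg by (auto simp: above_def below_def intro: cut)
  note z = core_state[OF filter_above ideal_below this]
  have "\<phi> \<in> filt ?z" "\<psi> \<in> idl ?z"
    using z(2,3) L_refl by (simp_all add: above_def below_def)
  then have "?z \<in> ext canon_frame canon_val \<phi>" "?z \<in> intn canon_frame canon_val \<psi>"
    using z(1) truth_lemma by (auto simp: canon_ext_def canon_int_def)
  then show False
    using assms is_valuation_canon canon_edges_refl[OF z(1)]
    by (auto simp: valid_on_def true_in_def)
qed

end

text \<open>Validity is assumed only over frames on pairs of formula sets, the type of the canonical
  frame.\<close>

theorem theorem1:
  fixes \<phi> \<psi> :: "'p fm"
  assumes two_atoms: "\<exists>p q :: 'p. p \<noteq> q"
    and valid: "\<And>F :: ('p fm set \<times> 'p fm set) frame. graph_frame F \<Longrightarrow> F \<Turnstile> \<phi> \<turnstile> \<psi>"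
  shows "\<phi> \<turnstile> \<psi> \<in> L"
proof (cases "(\<^bold>\<top> :: 'p fm) \<turnstile> \<^bold>\<bottom> \<in> L")
  \<comment> \<open>In an inconsistent logic, cuts through \<open>Top\<close> and \<open>Bot\<close>
    derive every sequent.\<close>
  case True
  then show ?thesis
    using L_top L_bot cut by blast
next
  case False
  obtain p q :: 'p where "p \<noteq> q"
    using two_atoms by blast
  with False interpret consistent_logic p q
    by unfold_locales
  show ?thesis
    using valid[OF graph_frame_canon] by (rule canon_complete)
qed

end
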